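(* Let $(a_j)_{j\ge 0}$ be a real sequence with $a_0=0$, $a_j\ge 0$ for all $j\ge 1$, $a_2>0$, and $a_j\le C\rho^j$ for all $j \geq 0$, for some constants $C,\rho>0$. Let $E$ and $S_N$ be defined from $(a_j)$ as in the context. (i) For every integer $K\ge 1$ and every even integer $N\ge 4$, $$S_N=\sum_{m=1}^{K}\frac{E(m\pi)}{m^N}+R_{N,K},\qquad |R_{N,K}|\le \frac{(K+2)\,E((K+1)\pi)}{(K+1)^N}.$$ (ii) For every fixed integer $K\ge 0$ define (with an empty sum, equal to $0$, when $K=0$) $$H_{N,K}=\frac{(K+1)^N}{E((K+1)\pi)}\left(S_N-\sum_{m=1}^{K}\frac{E(m\pi)}{m^N}\right).$$ Then $H_{N,K}\to 1$ as $N$ tends to infinity through even integers, and for every even integer $N\ge 4$, $$|H_{N,K}-1|\le \frac{(K+3)\,E((K+2)\pi)}{E((K+1)\pi)}\left(\frac{K+1}{K+2}\right)^N.$$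
   Context: $\zeta$ denotes the Riemann zeta function (meromorphically continued). For a sequence $(a_j)$ as in the claim, the even exponential generating function is $$E(t)=\sum_{j\ge 2,\ j\text{ even}} a_j\frac{t^j}{j!},$$ which is entire by the growth assumption and positive for real $t>0$. For an even integer $N\ge 4$ set $$t_{N,j}=N\binom{N-1}{j}a_j\,2^{N-j-1}\zeta(j+1-N)\quad(1\le j\le N-2),\qquad M_N=\sum_{j=1}^{N-2}|t_{N,j}|,\qquad S_N=\frac{\pi^N M_N}{N!}.$$ *)

theory Defs
  imports "HOL-Complex_Analysis.Complex_Analysis"
begin

(* The Riemann zeta function as the analytic continuation of its Dirichlet series.
   The value at the pole s = 1 is fixed to 0 (an arbitrary convention), so that the
   describing property has exactly one solution. *)
definition zeta :: "complex \<Rightarrow> complex" where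
  "zeta = (THE f. f holomorphic_on (- {1}) \<and> f 1 = 0 \<and>
     (\<forall>s. Re s > 1 \<longrightarrow> (\<lambda>n. 1 / of_nat (Suc n) powr s) sums f s))"

definition even_egf :: "(nat \<Rightarrow> real) \<Rightarrow> real \<Rightarrow> real" where
  "even_egf a t = (\<Sum>\<^sub>\<infinity>j\<in>{j. j \<ge> 2 \<and> even j}. a j * t ^ j / fact j)"

(* Only used for 1 \<le> j \<le> N - 2, so the exponent N - j - 1 is not truncated.
   The argument of zeta is the (negative) integer j + 1 - N. *)
definition t_term :: "(nat \<Rightarrow> real) \<Rightarrow> nat \<Rightarrow> nat \<Rightarrow> complex" where
  "t_term a N j = of_nat N * of_nat ((N - 1) choose j) * of_real (a j) * 2 ^ (N - j - 1)
     * zeta (of_int (int j + 1 - int N))"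

definition M_sum :: "(nat \<Rightarrow> real) \<Rightarrow> nat \<Rightarrow> real" where
  "M_sum a N = (\<Sum>j=1..N-2. cmod (t_term a N j))"

definition S_val :: "(nat \<Rightarrow> real) \<Rightarrow> nat \<Rightarrow> real" where
  "S_val a N = pi ^ N * M_sum a N / fact N"

definition H_val :: "(nat \<Rightarrow> real) \<Rightarrow> nat \<Rightarrow> nat \<Rightarrow> real" where
  "H_val a N K = real (K + 1) ^ N / even_egf a (real (K + 1) * pi) *
     (S_val a N - (\<Sum>m=1..K. even_egf a (real m * pi) / real m ^ N))"

end

theory Submission imports Defs begin

text \<open>
  Only the even \<open>j\<close> contribute to \<open>M\<^sub>N\<close>, and for those the functional equation turns
  \<open>\<pi>\<^sup>N |t\<^sub>N\<^sub>,\<^sub>j| / N!\<close> into \<open>a\<^sub>j \<pi>\<^sup>j / j! \<zeta>(N - j)\<close>. Expanding \<open>\<zeta>(N - j)\<close> as a Dirichlet series,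
  \<open>S\<^sub>N\<close> becomes the sum over \<open>m\<close> of the truncation of \<open>E(m \<pi>)\<close> to degrees below \<open>N\<close>, divided
  by \<open>m\<^sup>N\<close>. The terms with \<open>m > K\<close> decay at least like \<open>((K + 1) / m)\<^sup>2\<close> relative to the term
  \<open>m = K + 1\<close>, while the missing Taylor tails for \<open>m \<le> K\<close> are controlled by the tail at \<open>K + 1\<close>.
  Part (ii) is part (i) with \<open>K + 1\<close> in place of \<open>K\<close>.

  The required zeta values come from an entire \<open>Z\<close> with \<open>\<zeta>(s) = Z(s) / (s - 1)\<close>. Summing the Taylor
  expansion of \<open>(n + 1)\<^sup>1\<^sup>-\<^sup>s\<close> around \<open>n\<close> over all \<open>n\<close>, the left side telescopes and one gets a recurrence
  expressing \<open>Z(s)\<close> by \<open>Z(s + 1), Z(s + 2), \<dots>\<close> and a remainder that is holomorphic in a larger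
  half-plane. This continues \<open>Z\<close>; at integers \<open>s \<le> 1\<close> the expansion is finite, the remainder vanishes,
  and the recurrence is that of the Bernoulli numbers \<open>Z(1 - i)\<close>. Their generating function is then
  matched with the Taylor series of \<open>\<pi> z cot (\<pi> z)\<close>, which the reflection formula expresses by
  the Digamma function, whose Taylor coefficients at 1 are the numbers \<open>\<plusminus>\<zeta>(n)\<close>.
\<close>

subsection \<open>Analytic continuation of the zeta function\<close>

definition zeta_series :: "complex \<Rightarrow> complex" where
  "zeta_series s = (\<Sum>n. 1 / of_nat (Suc n) powr s)"

lemma zeta_series_sums:
  assumes "Re s > 1"
  shows "(\<lambda>n. 1 / of_nat (Suc n) powr s) sums zeta_series s"
proof -
  have "summable (\<lambda>n. (of_nat n :: complex) powr (-s))"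
    using assms by (intro summable_norm_cancel[where f = "\<lambda>n. (of_nat n :: complex) powr (-s)"])
      (simp add: norm_powr_real_powr summable_real_powr_iff)
  hence "summable (\<lambda>n. (of_nat (Suc n) :: complex) powr (-s))"
    by (subst summable_Suc_iff)
  hence "summable (\<lambda>n. 1 / (of_nat (Suc n) :: complex) powr s)"
    by (simp add: powr_minus_divide)
  thus ?thesis unfolding zeta_series_def by (rule summable_sums)
qed

text \<open>Error of the degree-\<open>K\<close> Taylor polynomial of \<open>x powr w\<close> about
  \<open>n\<close>, evaluated at \<open>n + 1\<close>. It is applied with
  \<open>w = 1 - s\<close>.\<close>

definition taylor_rem :: "nat \<Rightarrow> complex \<Rightarrow> nat \<Rightarrow> complex" where
  "taylor_rem K w n = of_nat (n + 1) powr w - (\<Sum>k\<le>K. (w gchoose k) * of_nat n powr (w - of_nat k))"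

text \<open>Taylor's theorem on the segment from \<open>n\<close> to \<open>n + 1\<close>. The
  margin \<open>\<delta>\<close> between \<open>Re w\<close> and \<open>K\<close> pushes the
  exponent of \<open>n\<close> below \<open>-1\<close>, so the errors can be summed over
  \<open>n\<close>.\<close>

lemma norm_taylor_rem_le:
  assumes "n \<ge> 1" "Re w \<le> real K - \<delta>" "\<delta> > 0"
  shows "norm (taylor_rem K w n) \<le> norm (\<Prod>i=0..<Suc K. w - of_nat i) * real n powr (-1 - \<delta>)"
proof -
  \<comment> \<open>\<open>?f i\<close> is the \<open>i\<close>-th derivative of
    \<open>z powr w\<close>.\<close>
  let ?f = "\<lambda>i z. (\<Prod>j=0..<i. w - of_nat j) * z powr (w - of_nat i)"
  let ?S = "closed_segment (of_nat n) (of_nat (Suc n)) :: complex set"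
  have S: "\<exists>x. z = of_real x \<and> x \<ge> real n" if "z \<in> ?S" for z
  proof -
    from that obtain u where "0 \<le> u" "u \<le> 1" "z = (1 - u) *\<^sub>R of_nat n + u *\<^sub>R of_nat (Suc n)"
      unfolding closed_segment_def by blast
    hence "z = of_real (real n + u)" by (simp add: scaleR_conv_of_real algebra_simps)
    with \<open>0 \<le> u\<close> show ?thesis by (intro exI[of _ "real n + u"]) auto
  qed
  have "norm (?f 0 (of_nat (Suc n)) - (\<Sum>i\<le>K. ?f i (of_nat n) * (of_nat (Suc n) - of_nat n) ^ i / fact i))
      \<le> norm (\<Prod>i=0..<Suc K. w - of_nat i) * real n powr (-1 - \<delta>)
          * norm (of_nat (Suc n) - of_nat n :: complex) ^ Suc K / fact K"
  proof (rule complex_Taylor[where S = ?S])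
    show "convex ?S" by simp
  next
    fix i z assume z: "z \<in> ?S" "i \<le> K"
    from S[OF z(1)] assms obtain x where x: "z = of_real x" "x > 0" by force
    hence "z \<notin> \<real>\<^sub>\<le>\<^sub>0" by auto
    thus "(?f i has_field_derivative ?f (Suc i) z) (at z within ?S)"
      by (auto intro!: derivative_eq_intros simp: algebra_simps)
  next
    fix z assume z: "z \<in> ?S"
    from S[OF z] assms obtain x where x: "z = of_real x" "x > 0" "x \<ge> real n" by force
    have "norm (z powr (w - of_nat (Suc K))) = x powr (Re w - real (Suc K))"
      using x by (simp add: norm_powr_real_powr)
    also have "\<dots> \<le> real n powr (Re w - real (Suc K))"
      using x assms by (intro powr_mono2') auto
    also have "\<dots> \<le> real n powr (-1 - \<delta>)"
      using assms by (intro powr_mono) auto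
    finally show "norm (?f (Suc K) z) \<le> norm (\<Prod>i=0..<Suc K. w - of_nat i) * real n powr (-1 - \<delta>)"
      unfolding norm_mult by (intro mult_left_mono) auto
  qed auto
  also have "?f 0 (of_nat (Suc n)) - (\<Sum>i\<le>K. ?f i (of_nat n) * (of_nat (Suc n) - of_nat n) ^ i / fact i)
      = taylor_rem K w n"
    by (simp add: taylor_rem_def gbinomial_prod_rev add.commute)
  also have "norm (\<Prod>i=0..<Suc K. w - of_nat i) * real n powr (-1 - \<delta>)
          * norm (of_nat (Suc n) - of_nat n :: complex) ^ Suc K / fact K \<le>
     norm (\<Prod>i=0..<Suc K. w - of_nat i) * real n powr (-1 - \<delta>)"
  proof -
    have "x / fact K \<le> x" if "x \<ge> 0" for x :: real
      using that by (simp add: divide_le_eq fact_ge_1 mult_left_le mult_le_cancel_left1)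
    moreover have "norm (of_nat (Suc n) - of_nat n :: complex) = 1" by simp
    ultimately show ?thesis by (metis mult.right_neutral norm_ge_zero powr_ge_zero power_one zero_le_mult_iff)
  qed
  finally show ?thesis .
qed

definition taylor_sum :: "nat \<Rightarrow> complex \<Rightarrow> complex" where
  "taylor_sum K s = (\<Sum>n. taylor_rem K (1 - s) (Suc n))"

lemma summable_Suc_powr: "\<delta> > 0 \<Longrightarrow> summable (\<lambda>n. real (Suc n) powr (-1 - \<delta>))"
  by (subst summable_Suc_iff) (simp add: summable_real_powr_iff)

lemma open_halfplane_Re: "open {s. Re s > c}"
  by (simp add: open_halfspace_Re_gt)

text \<open>On a small ball the polynomial factor in the error bound is bounded by compactness, and
  the M-test makes the holomorphic partial sums converge uniformly there.\<close>

lemma holomorphic_taylor_sum: "taylor_sum K holomorphic_on {s. Re s > 1 - real K}"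
proof (rule holomorphic_uniform_sequence[where f = "\<lambda>m s. \<Sum>n<m. taylor_rem K (1 - s) (Suc n)"])
  show "open {s. Re s > 1 - real K}" by (rule open_halfplane_Re)
next
  fix m
  show "(\<lambda>s. \<Sum>n<m. taylor_rem K (1 - s) (Suc n)) holomorphic_on {s. 1 - real K < Re s}"
    unfolding taylor_rem_def gbinomial_prod_rev by (auto intro!: holomorphic_intros simp del: of_nat_Suc)
next
  fix s assume s: "s \<in> {s. Re s > 1 - real K}"
  \<comment> \<open>Half the distance to the boundary line, so that every point of
    \<open>cball s \<delta>\<close> keeps the margin \<open>\<delta>\<close>.\<close>
  define \<delta> where "\<delta> = (Re s - (1 - real K)) / 2"
  have \<delta>: "\<delta> > 0" using s by (simp add: \<delta>_def)
  have *: "Re z \<ge> 1 - real K + \<delta>" if "z \<in> cball s \<delta>" for z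
  proof -
    have "\<bar>Re (s - z)\<bar> \<le> \<delta>" using that abs_Re_le_cmod[of "s - z"] by (simp add: dist_norm)
    hence "Re z \<ge> Re s - \<delta>" unfolding minus_complex.simps by linarith
    moreover have "Re s - \<delta> = 1 - real K + \<delta>" by (simp add: \<delta>_def field_simps)
    ultimately show ?thesis by simp
  qed
  have "compact ((\<lambda>z. \<Prod>i=0..<Suc K. (1 - z) - of_nat i) ` cball s \<delta>)"
    by (intro compact_continuous_image continuous_intros) auto
  then obtain B where B: "\<And>z. z \<in> cball s \<delta> \<Longrightarrow> norm (\<Prod>i=0..<Suc K. (1 - z) - of_nat i) \<le> B"
    by (meson bounded_iff compact_imp_bounded imageI)
  have "uniform_limit (cball s \<delta>) (\<lambda>m s. \<Sum>n<m. taylor_rem K (1 - s) (Suc n)) (taylor_sum K) sequentially"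
    unfolding taylor_sum_def
  proof (rule Weierstrass_m_test)
    show "summable (\<lambda>n. B * real (Suc n) powr (-1 - \<delta>))"
      by (intro summable_mult summable_Suc_powr \<delta>)
  next
    fix n z assume z: "z \<in> cball s \<delta>"
    have "norm (taylor_rem K (1 - z) (Suc n)) \<le>
        norm (\<Prod>i=0..<Suc K. (1 - z) - of_nat i) * real (Suc n) powr (-1 - \<delta>)"
      using *[OF z] \<delta> by (intro norm_taylor_rem_le) auto
    also have "\<dots> \<le> B * real (Suc n) powr (-1 - \<delta>)"
      by (intro mult_right_mono B z) auto
    finally show "norm (taylor_rem K (1 - z) (Suc n)) \<le> B * real (Suc n) powr (-1 - \<delta>)" .
  qed
  thus "\<exists>d>0. cball s d \<subseteq> {s. 1 - real K < Re s} \<and>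
          uniform_limit (cball s d) (\<lambda>m s. \<Sum>n<m. taylor_rem K (1 - s) (Suc n)) (taylor_sum K) sequentially"
    using \<delta> * by (intro exI[of _ \<delta>]) force
qed

text \<open>Sum the Taylor expansions about \<open>n = 1, 2, ...\<close>: the increments telescope,
  and the terms of order \<open>j + 1\<close> add up to a multiple of
  \<open>zeta_series (s + of_nat j)\<close>.\<close>

lemma zeta_series_recurrence:
  assumes "Re s > 1"
  shows "(\<Sum>j<K. ((1 - s) gchoose j) / of_nat (Suc j) * ((s + of_nat j - 1) * zeta_series (s + of_nat j)))
           = 1 + taylor_sum K s"
proof -
  have lim: "(\<lambda>n. (of_nat (Suc n) :: complex) powr (1 - s)) \<longlonglongrightarrow> 0"
  proof (rule tendsto_norm_zero_cancel)
    have "(\<lambda>n. real (Suc n) powr (1 - Re s)) \<longlonglongrightarrow> 0"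
      using assms by (intro tendsto_neg_powr filterlim_compose[OF filterlim_real_sequentially filterlim_Suc]) auto
    thus "(\<lambda>n. norm ((of_nat (Suc n) :: complex) powr (1 - s))) \<longlonglongrightarrow> 0"
      by (simp add: norm_powr_real_powr del: of_nat_Suc)
  qed
  have tele: "(\<lambda>n. of_nat (Suc (Suc n)) powr (1 - s) - of_nat (Suc n) powr (1 - s)) sums (- 1 :: complex)"
    using telescope_sums[OF lim] by simp
  have sums: "(\<lambda>n. ((1 - s) gchoose Suc j) * of_nat (Suc n) powr (1 - s - of_nat (Suc j)))
      sums (((1 - s) gchoose Suc j) * zeta_series (s + of_nat j))" for j
  proof -
    have "(\<lambda>n. of_nat (Suc n) powr (1 - s - of_nat (Suc j))) sums zeta_series (s + of_nat j)"
      using zeta_series_sums[of "s + of_nat j"] assms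
      by (simp add: powr_minus_divide [symmetric] del: of_nat_Suc) (simp add: algebra_simps)
    thus ?thesis by (rule sums_mult)
  qed
  have "(\<lambda>n. of_nat (Suc (Suc n)) powr (1 - s) - of_nat (Suc n) powr (1 - s)
           - (\<Sum>j<K. ((1 - s) gchoose Suc j) * of_nat (Suc n) powr (1 - s - of_nat (Suc j))))
        sums (- 1 - (\<Sum>j<K. ((1 - s) gchoose Suc j) * zeta_series (s + of_nat j)))"
    by (intro sums_diff tele sums_sum sums)
  also have "(\<lambda>n. of_nat (Suc (Suc n)) powr (1 - s) - of_nat (Suc n) powr (1 - s)
           - (\<Sum>j<K. ((1 - s) gchoose Suc j) * of_nat (Suc n) powr (1 - s - of_nat (Suc j))))
       = (\<lambda>n. taylor_rem K (1 - s) (Suc n))"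
    unfolding taylor_rem_def sum.atMost_shift by (auto simp: algebra_simps)
  finally have "taylor_sum K s = - 1 - (\<Sum>j<K. ((1 - s) gchoose Suc j) * zeta_series (s + of_nat j))"
    unfolding taylor_sum_def by (rule sums_unique [symmetric])
  \<comment> \<open>Splitting the last factor off the binomial coefficient yields
    \<open>s + of_nat j - 1\<close>, which is what cancels the pole of the zeta value next to
    it.\<close>
  moreover have "((1 - s) gchoose Suc j) = - (((1 - s) gchoose j) / of_nat (Suc j) * (s + of_nat j - 1))" for j
    using gbinomial_mult_1[of "1 - s" j] by (simp add: divide_simps del: of_nat_Suc) (simp add: algebra_simps)
  ultimately show ?thesis by (simp add: sum_negf mult.assoc)
qed

lemma halfplane_continuation_unique:
  assumes "f holomorphic_on {s. Re s > c}" "g holomorphic_on {s. Re s > c}"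
    "\<And>s. Re s > d \<Longrightarrow> f s = g s" "Re s > c"
  shows "f s = g s"
proof (rule analytic_continuation_open[where f = f and g = g and s = "{s. Re s > max c d}" and s' = "{s. Re s > c}"])
  have "of_real (max c d + 1) \<in> {s. Re s > max c d}" by (simp add: max_def)
  thus "{s. Re s > max c d} \<noteq> {}" by blast
  show "open {s. Re s > max c d}" by (rule open_halfplane_Re)
  show "connected {s. Re s > c}" by (intro convex_connected convex_halfspace_Re_gt)
qed (use assms open_halfplane_Re in auto)

text \<open>Solve the recurrence for its \<open>j = 0\<close> term: the other terms sit at
  \<open>s + 1, s + 2, ...\<close>, where the continuation from the previous step is already
  available.\<close>

lemma zeta_halfplane_continuation:
  "\<exists>F. F holomorphic_on {s. Re s > 1 - real K} \<and> (\<forall>s. Re s > 1 \<longrightarrow> F s = (s - 1) * zeta_series s)"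
proof (induction K)
  case 0
  let ?F = "\<lambda>s. 1 + taylor_sum 1 s"
  have "?F holomorphic_on {s. Re s > 1 - real 1}"
    by (intro holomorphic_intros holomorphic_taylor_sum)
  hence "?F holomorphic_on {s. Re s > 1 - real 0}"
    by (rule holomorphic_on_subset) auto
  moreover have "?F s = (s - 1) * zeta_series s" if "Re s > 1" for s
    using zeta_series_recurrence[OF that, of 1] by simp
  ultimately show ?case by blast
next
  case (Suc K)
  then obtain F where F: "F holomorphic_on {s. Re s > 1 - real K}"
    "\<And>s. Re s > 1 \<Longrightarrow> F s = (s - 1) * zeta_series s" by blast
  let ?G = "\<lambda>s. 1 + taylor_sum (Suc K) s -
      (\<Sum>j<K. ((1 - s) gchoose Suc j) / of_nat (Suc (Suc j)) * F (s + of_nat (Suc j)))"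
  have "(\<lambda>s. F (s + of_nat (Suc j))) holomorphic_on {s. Re s > 1 - real (Suc K)}" for j
    by (rule holomorphic_on_compose_gen[OF _ F(1), unfolded o_def]) (auto intro!: holomorphic_intros)
  hence "?G holomorphic_on {s. Re s > 1 - real (Suc K)}"
    unfolding gbinomial_prod_rev
    by (intro holomorphic_intros holomorphic_taylor_sum) (auto simp del: of_nat_Suc)
  moreover have "?G s = (s - 1) * zeta_series s" if "Re s > 1" for s
    using zeta_series_recurrence[OF that, of "Suc K"] that
    by (subst (asm) sum.lessThan_Suc_shift) (simp add: F(2) algebra_simps)
  ultimately show ?case by blast
qed

lemma zeta_entire_continuation:
  obtains Z where "Z holomorphic_on UNIV" "\<And>s. Re s > 1 \<Longrightarrow> Z s = (s - 1) * zeta_series s"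
proof -
  obtain F where F: "\<And>K. F K holomorphic_on {s. Re s > 1 - real K}"
     "\<And>K s. Re s > 1 \<Longrightarrow> F K s = (s - 1) * zeta_series s"
    using zeta_halfplane_continuation by metis
  have eq: "F K s = F L s" if "K \<le> L" "Re s > 1 - real K" for K L s
  proof (rule halfplane_continuation_unique[where f = "F K" and g = "F L" and c = "1 - real K" and d = 1])
    show "F L holomorphic_on {s. Re s > 1 - real K}"
      using F(1)[of L] by (rule holomorphic_on_subset) (use that in auto)
    show "F K z = F L z" if "Re z > 1" for z
      using F(2)[OF that, of K] F(2)[OF that, of L] by simp
  qed (use F(1) that in blast)+
  have eq': "F K s = F L s" if "Re s > 1 - real K" "Re s > 1 - real L" for K L s
    using eq[of K L s] eq[of L K s] that nat_le_linear[of K L] by fastforce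
  have ex: "\<exists>K. Re s > 1 - real K" for s
    using reals_Archimedean2[of "1 - Re s"] by (auto simp: algebra_simps)
  \<comment> \<open>By \<open>eq'\<close> the value does not depend on which admissible
    \<open>K\<close> is chosen, so the half-plane continuations glue.\<close>
  define Z where "Z = (\<lambda>s. F (SOME K. Re s > 1 - real K) s)"
  have Z: "Z s = F K s" if "Re s > 1 - real K" for s K
    unfolding Z_def using someI_ex[OF ex[of s]] that by (intro eq')
  have "Z holomorphic_on (\<Union>K. {s. Re s > 1 - real K})"
  proof (rule holomorphic_on_UN_open)
    fix K show "Z holomorphic_on {s. Re s > 1 - real K}"
      using F(1)[of K] by (rule holomorphic_transform) (simp add: Z)
  qed (rule open_halfplane_Re)
  moreover have "(\<Union>K. {s. Re s > 1 - real K}) = UNIV" using ex by auto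
  ultimately have "Z holomorphic_on UNIV" by simp
  moreover have "Z s = (s - 1) * zeta_series s" if "Re s > 1" for s
    using Z[of 0 s] F(2)[of s 0] that by simp
  ultimately show ?thesis by (rule that)
qed

text \<open>Resolves the definite description in \<open>zeta\<close>: the identity theorem on the
  connected punctured plane gives uniqueness off 1, and the value at 1 is prescribed.\<close>

lemma zeta_eqI:
  assumes "f holomorphic_on - {1}" "f 1 = 0" "\<And>s. Re s > 1 \<Longrightarrow> f s = zeta_series s"
  shows "zeta = f"
  unfolding zeta_def
proof (rule the_equality)
  show "f holomorphic_on - {1} \<and> f 1 = 0 \<and> (\<forall>s. 1 < Re s \<longrightarrow> (\<lambda>n. 1 / of_nat (Suc n) powr s) sums f s)"
    using assms zeta_series_sums by auto
next
  fix g assume g: "g holomorphic_on - {1} \<and> g 1 = 0 \<and> (\<forall>s. 1 < Re s \<longrightarrow> (\<lambda>n. 1 / of_nat (Suc n) powr s) sums g s)"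
  have "g s = f s" if "s \<noteq> 1" for s
  proof (rule analytic_continuation_open[where f = g and g = f and s = "{s. Re s > 1}" and s' = "- {1}"])
    have "2 \<in> {s::complex. Re s > 1}" by simp
    thus "{s::complex. Re s > 1} \<noteq> {}" by blast
    show "connected (- {1 :: complex})"
      by (rule connected_punctured_universe) simp
    show "g z = f z" if "z \<in> {s. Re s > 1}" for z
      using that g assms(3) zeta_series_sums sums_unique2 by (metis mem_Collect_eq)
  qed (use g assms that open_halfplane_Re in auto)
  thus "g = f" using g assms(2) by (metis ext)
qed

lemma zeta_entire_numerator:
  obtains Z where "\<And>s. zeta s = Z s / (s - 1)"
    and "\<And>K s. Re s > 1 - real K \<Longrightarrow>
      (\<Sum>j<K. ((1 - s) gchoose j) / of_nat (Suc j) * Z (s + of_nat j)) = 1 + taylor_sum K s"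
proof -
  obtain Z where Z: "Z holomorphic_on UNIV" "\<And>s. Re s > 1 \<Longrightarrow> Z s = (s - 1) * zeta_series s"
    using zeta_entire_continuation by blast
  \<comment> \<open>At the pole \<open>s = 1\<close> both sides are 0, since \<open>x / 0 = 0\<close>.\<close>
  have "zeta = (\<lambda>s. Z s / (s - 1))"
  proof (rule zeta_eqI)
    show "(\<lambda>s. Z s / (s - 1)) holomorphic_on - {1}"
      by (intro holomorphic_intros holomorphic_on_subset[OF Z(1)]) auto
    show "Z s / (s - 1) = zeta_series s" if "Re s > 1" for s
      using that Z(2)[of s] by (cases "s = 1") auto
  qed auto
  \<comment> \<open>The recurrence is known for \<open>Re s > 1\<close> and persists on the larger
    half-plane because both sides are holomorphic there.\<close>
  moreover have "(\<Sum>j<K. ((1 - s) gchoose j) / of_nat (Suc j) * Z (s + of_nat j)) = 1 + taylor_sum K s"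
    if "Re s > 1 - real K" for K s
  proof (rule halfplane_continuation_unique[where f = "\<lambda>s. \<Sum>j<K. ((1 - s) gchoose j) / of_nat (Suc j) * Z (s + of_nat j)"
        and g = "\<lambda>s. 1 + taylor_sum K s" and c = "1 - real K" and d = 1])
    have "(\<lambda>s. Z (s + of_nat j)) holomorphic_on {s. Re s > 1 - real K}" for j
      by (rule holomorphic_on_compose_gen[OF _ Z(1), unfolded o_def]) (auto intro!: holomorphic_intros)
    thus "(\<lambda>s. \<Sum>j<K. ((1 - s) gchoose j) / of_nat (Suc j) * Z (s + of_nat j)) holomorphic_on {s. Re s > 1 - real K}"
      unfolding gbinomial_prod_rev by (intro holomorphic_intros) (auto simp del: of_nat_Suc)
    show "(\<lambda>s. 1 + taylor_sum K s) holomorphic_on {s. Re s > 1 - real K}"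
      by (intro holomorphic_intros holomorphic_taylor_sum)
    show "(\<Sum>j<K. ((1 - s) gchoose j) / of_nat (Suc j) * Z (s + of_nat j)) = 1 + taylor_sum K s"
      if "Re s > 1" for s
      using zeta_series_recurrence[OF that, of K] that by (simp add: Z(2))
  qed fact
  ultimately show ?thesis using that by metis
qed

subsection \<open>Values at the negative integers\<close>

text \<open>For a natural exponent at most \<open>K\<close> the Taylor polynomial is the complete
  binomial expansion of \<open>(n + 1) ^ m\<close>.\<close>

lemma taylor_rem_of_nat:
  assumes "m \<le> K" "n > 0"
  shows "taylor_rem K (of_nat m) n = 0"
proof -
  have "(\<Sum>k\<le>K. (of_nat m gchoose k) * (of_nat n :: complex) powr (of_nat m - of_nat k)) =
        (\<Sum>k\<le>m. of_nat (m choose k) * of_nat n ^ (m - k))"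
  proof (rule sum.mono_neutral_cong_right)
    show "\<forall>i\<in>{..K} - {..m}. (of_nat m gchoose i) * (of_nat n :: complex) powr (of_nat m - of_nat i) = 0"
      by (auto simp: binomial_gbinomial [symmetric])
    show "(of_nat m gchoose k) * (of_nat n :: complex) powr (of_nat m - of_nat k) =
        of_nat (m choose k) * of_nat n ^ (m - k)" if "k \<in> {..m}" for k
      using that assms by (simp add: binomial_gbinomial [symmetric] of_nat_diff [symmetric] powr_nat' del: of_nat_diff)
  qed (use assms in auto)
  also have "\<dots> = (1 + of_nat n) ^ m"
    by (subst binomial_ring) simp
  finally have "taylor_rem K (of_nat m) n = of_nat (Suc n) powr of_nat m - of_nat (Suc n) ^ m"
    by (simp add: taylor_rem_def)
  thus ?thesis
    by (simp add: powr_nat' del: of_nat_Suc)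
qed

text \<open>The recurrence at \<open>s = 1 - n\<close>, read in reverse order and divided by
  \<open>fact n\<close>. It is the Bernoulli recurrence for the numbers
  \<open>Z (1 - of_nat i)\<close>.\<close>

lemma zeta_numerator_convolution:
  assumes rec: "\<And>K s. Re s > 1 - real K \<Longrightarrow>
      (\<Sum>j<K. ((1 - s) gchoose j) / of_nat (Suc j) * Z (s + of_nat j)) = 1 + taylor_sum K s"
  shows "(\<Sum>i\<le>n. Z (1 - of_nat i) / fact i * (1 / fact (Suc n - i))) = 1 / fact n"
proof -
  \<comment> \<open>\<open>Suc n\<close> is the least order whose half-plane contains
    \<open>1 - n\<close>; it also exceeds the exponent \<open>n\<close>, so the remainder
    vanishes.\<close>
  have "(\<Sum>j<Suc n. ((1 - (1 - of_nat n)) gchoose j) / of_nat (Suc j) * Z (1 - of_nat n + of_nat j)) = 1"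
    using rec[of "Suc n" "1 - of_nat n"]
    by (simp add: taylor_sum_def taylor_rem_of_nat del: of_nat_Suc)
  also have "(\<Sum>j<Suc n. ((1 - (1 - of_nat n)) gchoose j) / of_nat (Suc j) * Z (1 - of_nat n + of_nat j)) =
     (\<Sum>i<Suc n. fact n * (Z (1 - of_nat i) / fact i * (1 / fact (Suc n - i))))"
  proof (subst sum.nat_diff_reindex [symmetric], rule sum.cong)
    fix i assume "i \<in> {..<Suc n}"
    hence i: "i \<le> n" by simp
    have "(of_nat n gchoose (n - i)) = (fact n / (fact (n - i) * fact i) :: complex)"
      using i by (simp add: binomial_gbinomial [symmetric] binomial_fact)
    moreover have "fact (Suc n - i) = (of_nat (Suc (n - i)) * fact (n - i) :: complex)"
      using i by (simp add: Suc_diff_le)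
    moreover have arg: "(1 - of_nat n + of_nat (n - i)) = (1 - of_nat i :: complex)"
      using i by (simp add: of_nat_diff)
    ultimately show "((1 - (1 - of_nat n)) gchoose (Suc n - Suc i)) / of_nat (Suc (Suc n - Suc i)) *
        Z (1 - of_nat n + of_nat (Suc n - Suc i)) =
        fact n * (Z (1 - of_nat i) / fact i * (1 / fact (Suc n - i)))"
      unfolding diff_Suc_Suc arg by (simp del: of_nat_Suc)
  qed auto
  finally have "fact n * (\<Sum>i\<le>n. Z (1 - of_nat i) / fact i * (1 / fact (Suc n - i))) = 1"
    by (simp only: sum_distrib_left [symmetric] lessThan_Suc_atMost)
  thus ?thesis by (metis fact_nonzero nonzero_eq_divide_eq mult.commute)
qed

text \<open>The Bernoulli generating function, with value 1/2 at index 1. It is kept in product form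
  because \<open>fps_exp c - 1\<close> has zero constant term.\<close>

lemma zeta_numerator_egf:
  assumes rec: "\<And>K s. Re s > 1 - real K \<Longrightarrow>
      (\<Sum>j<K. ((1 - s) gchoose j) / of_nat (Suc j) * Z (s + of_nat j)) = 1 + taylor_sum K s"
  shows "Abs_fps (\<lambda>i. c ^ i * Z (1 - of_nat i) / fact i) * (fps_exp c - 1) = fps_const c * fps_X * fps_exp c"
proof (rule fps_ext)
  fix N
  show "fps_nth (Abs_fps (\<lambda>i. c ^ i * Z (1 - of_nat i) / fact i) * (fps_exp c - 1)) N =
        fps_nth (fps_const c * fps_X * fps_exp c) N"
  proof (cases N)
    case (Suc n)
    have "fps_nth (Abs_fps (\<lambda>i. c ^ i * Z (1 - of_nat i) / fact i) * (fps_exp c - 1)) N =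
      (\<Sum>i\<le>n. c ^ i * Z (1 - of_nat i) / fact i * (c ^ (Suc n - i) / fact (Suc n - i)))"
    proof -
      have "fps_nth (fps_exp c - 1) (Suc n - i) = c ^ (Suc n - i) / fact (Suc n - i)" if "i \<le> n" for i
        using that by (simp del: fact_Suc)
      thus ?thesis unfolding fps_mult_nth Suc atLeast0AtMost sum.atMost_Suc
        by (simp del: fact_Suc power_Suc)
    qed
    also have "\<dots> = (\<Sum>i\<le>n. c ^ Suc n * (Z (1 - of_nat i) / fact i * (1 / fact (Suc n - i))))"
    proof (intro sum.cong refl)
      fix i assume "i \<in> {..n}"
      hence "c ^ Suc n = c ^ i * c ^ (Suc n - i)" by (simp add: power_add [symmetric])
      thus "c ^ i * Z (1 - of_nat i) / fact i * (c ^ (Suc n - i) / fact (Suc n - i)) =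
        c ^ Suc n * (Z (1 - of_nat i) / fact i * (1 / fact (Suc n - i)))" by simp
    qed
    also have "\<dots> = c ^ Suc n * (1 / fact n)"
      by (simp only: sum_distrib_left [symmetric] zeta_numerator_convolution[OF rec])
    also have "\<dots> = fps_nth (fps_const c * fps_X * fps_exp c) N"
      by (simp add: Suc mult.assoc)
    finally show ?thesis .
  qed auto
qed

section \<open>The cotangent through the Digamma function\<close>

lemma Digamma_reflection:
  fixes z :: complex
  assumes "z \<notin> \<int>"
  shows "(Digamma (1 - z) - Digamma z) * sin (of_real pi * z) = of_real pi * cos (of_real pi * z)"
proof -
  have z: "z \<notin> \<int>\<^sub>\<le>\<^sub>0" "1 - z \<notin> \<int>\<^sub>\<le>\<^sub>0"
    using assms nonpos_Ints_subset_Ints Ints_diff[of 1 "1 - z"] by auto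
  \<comment> \<open>Both sides of the reflection formula for \<open>rGamma\<close> are
    differentiated and the derivatives compared.\<close>
  let ?g = "\<lambda>z. rGamma z * rGamma (1 - z) :: complex"
  have 1: "(?g has_field_derivative (rGamma z * rGamma (1 - z) * (Digamma (1 - z) - Digamma z))) (at z)"
    using z by (auto intro!: derivative_eq_intros simp: algebra_simps)
  have "?g = (\<lambda>z. sin (of_real pi * z) / of_real pi)"
    using rGamma_reflection_complex by blast
  moreover have "((\<lambda>z. sin (of_real pi * z) / of_real pi) has_field_derivative cos (of_real pi * z)) (at z)"
    by (auto intro!: derivative_eq_intros)
  ultimately have "rGamma z * rGamma (1 - z) * (Digamma (1 - z) - Digamma z) = cos (of_real pi * z)"
    using 1 DERIV_unique by metis
  thus ?thesis by (simp add: rGamma_reflection_complex field_simps)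
qed

text \<open>The expansion
  \<open>pi z cot (pi z) = 1 + z (Digamma (1 - z) - Digamma (1 + z))\<close>, with the cotangent
  written by exponentials and denominators cleared. Passing from \<open>Digamma z\<close> to
  \<open>Digamma (1 + z)\<close> removes the pole at 0, so power series can be taken there.\<close>

lemma cot_Digamma:
  fixes z :: complex
  assumes "z \<notin> \<int>"
  shows "(1 + z * (Digamma (1 - z) - Digamma (1 + z))) * (exp (2 * of_real pi * \<i> * z) - 1) =
         of_real pi * \<i> * z * (exp (2 * of_real pi * \<i> * z) + 1)"
proof -
  \<comment> \<open>Sine and cosine of \<open>pi z\<close> are rational in \<open>y\<close>, which
    reduces the claim to algebra.\<close>
  define y where "y = exp (\<i> * (of_real pi * z))"
  have y: "y \<noteq> 0" "exp (2 * of_real pi * \<i> * z) = y ^ 2"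
    by (simp_all add: y_def exp_double [symmetric] algebra_simps)
  have sc: "sin (of_real pi * z) = (y - 1 / y) / (2 * \<i>)" "cos (of_real pi * z) = (y + 1 / y) / 2"
    unfolding sin_exp_eq cos_exp_eq y_def by (simp_all add: exp_minus field_simps)
  have z: "z \<noteq> 0" using assms by auto
  have "Digamma (1 + z) = Digamma z + 1 / z"
    using Digamma_plus1[OF z] by (simp add: add.commute)
  hence "1 + z * (Digamma (1 - z) - Digamma (1 + z)) = z * (Digamma (1 - z) - Digamma z)"
    using z by (simp add: field_simps)
  moreover have "(Digamma (1 - z) - Digamma z) * (y ^ 2 - 1) = of_real pi * \<i> * (y ^ 2 + 1)"
  proof -
    have gen: "u * (v * y) = u * (v / w) * (w * y)" if "w \<noteq> 0" for u v w y :: complex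
      using that by simp
    have "(Digamma (1 - z) - Digamma z) * ((y - 1 / y) * y) =
        (Digamma (1 - z) - Digamma z) * ((y - 1 / y) / (2 * \<i>)) * (2 * \<i> * y)"
      using gen[of "2 * \<i>"] by (metis complex_i_not_zero mult_eq_0_iff zero_neq_numeral)
    also have "\<dots> = of_real pi * ((y + 1 / y) / 2) * (2 * \<i> * y)"
      by (simp only: Digamma_reflection[OF assms, unfolded sc])
    also have "\<dots> = of_real pi * \<i> * ((y + 1 / y) * y)"
      by simp
    finally show ?thesis using y(1) by (simp add: ring_distribs power2_eq_square)
  qed
  ultimately show ?thesis unfolding y by (simp only: mult.assoc) (simp only: mult_ac)
qed

lemma Digamma_fps: "(\<lambda>x. Digamma (1 + x)) has_fps_expansion Abs_fps (\<lambda>n. Polygamma n 1 / fact n :: complex)"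
proof -
  have "(\<lambda>x. Digamma (1 + x)) has_fps_expansion fps_expansion Digamma (1::complex)"
    by (intro analytic_at_imp_has_fps_expansion analytic_on_Polygamma) auto
  thus ?thesis
    by (simp add: fps_expansion_def higher_deriv_Polygamma)
qed

lemma Polygamma_at_1:
  assumes "n \<ge> 1"
  shows "Polygamma n (1::complex) = (-1) ^ Suc n * fact n * zeta_series (of_nat (Suc n))"
proof -
  have "(\<lambda>k. inverse ((1 + of_nat k) ^ Suc n)) sums ((-1) ^ Suc n * Polygamma n (1::complex) / fact n)"
    using assms by (intro Polygamma_LIMSEQ) auto
  moreover have "(\<lambda>k. 1 / of_nat (Suc k) powr of_nat (Suc n)) sums zeta_series (of_nat (Suc n))"
    using assms by (intro zeta_series_sums) auto
  hence "(\<lambda>k. inverse ((1 + of_nat k) ^ Suc n)) sums zeta_series (of_nat (Suc n))"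
  proof -
    have "1 / of_nat (Suc k) powr of_nat (Suc n) = inverse ((1 + of_nat k :: complex) ^ Suc n)" for k
      by (subst powr_nat') (auto simp: inverse_eq_divide simp del: power_Suc)
    thus ?thesis using \<open>_ sums zeta_series _\<close> by (simp only:)
  qed
  ultimately have "(-1) ^ Suc n * Polygamma n (1::complex) / fact n = zeta_series (of_nat (Suc n))"
    by (rule sums_unique2)
  hence "zeta_series (of_nat (Suc n)) * fact n = (-1) ^ Suc n * Polygamma n 1"
    by (metis fact_nonzero nonzero_eq_divide_eq)
  moreover have "(-1) ^ Suc n * ((-1) ^ Suc n * x) = x" for x :: complex
    by (cases "even n") simp_all
  ultimately show ?thesis by (metis mult.assoc mult.commute)
qed

text \<open>Euler's relation between Bernoulli numbers and zeta values. The Bernoulli generating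
  function and the cotangent expansion satisfy the same equation after multiplication by
  \<open>fps_exp c - 1\<close>, so their coefficients agree.\<close>

lemma zeta_numerator_at_negatives:
  assumes rec: "\<And>K s. Re s > 1 - real K \<Longrightarrow>
      (\<Sum>j<K. ((1 - s) gchoose j) / of_nat (Suc j) * Z (s + of_nat j)) = 1 + taylor_sum K s"
    and n: "n \<ge> 2"
  shows "(2 * of_real pi * \<i>) ^ n * Z (1 - of_nat n) / fact n = (if even n then - 2 * zeta_series (of_nat n) else 0)"
proof -
  define c where "c = 2 * of_real pi * \<i>"
  define D where "D = Abs_fps (\<lambda>n. Polygamma n 1 / fact n :: complex)"
  define D' where "D' = Abs_fps (\<lambda>n. (-1) ^ n * fps_nth D n)"
  define G where "G = 1 + fps_X * (D' - D)"
  have D: "(\<lambda>x. Digamma (1 + x)) has_fps_expansion D"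
    unfolding D_def by (rule Digamma_fps)
  have D': "(\<lambda>x. Digamma (1 - x)) has_fps_expansion D'"
  proof -
    have "((\<lambda>x. Digamma (1 + x)) \<circ> (\<lambda>x. - x)) has_fps_expansion fps_compose D (- fps_X)"
      by (intro has_fps_expansion_compose D fps_expansion_intros) auto
    also have "fps_compose D (- fps_X) = D'"
      
    proof -
      have "(- fps_X :: complex fps) = fps_const (-1) * fps_X"
        by (rule fps_ext) simp
      thus ?thesis using fps_compose_linear[of D "-1"] by (simp only: D'_def)
    qed
    finally show ?thesis by (simp add: o_def)
  qed
  have lhs: "(\<lambda>z. (1 + z * (Digamma (1 - z) - Digamma (1 + z))) * (exp (c * z) - 1))
      has_fps_expansion G * (fps_exp c - 1)"
    unfolding G_def by (intro fps_expansion_intros D D')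
  have rhs: "(\<lambda>z. c / 2 * z * (exp (c * z) + 1)) has_fps_expansion fps_const (c / 2) * fps_X * (fps_exp c + 1)"
    by (intro fps_expansion_intros)
  \<comment> \<open>The only integer in the unit ball is 0, and there both sides are 0.\<close>
  have eq: "eventually (\<lambda>z. (1 + z * (Digamma (1 - z) - Digamma (1 + z))) * (exp (c * z) - 1) =
        c / 2 * z * (exp (c * z) + 1)) (nhds 0)"
  proof -
    have "eventually (\<lambda>z. z \<in> ball 0 1) (nhds (0::complex))"
      by (intro eventually_nhds_in_open) auto
    thus ?thesis
    proof eventually_elim
      case (elim z)
      show ?case
      proof (cases "z = 0")
        case False
        have "z \<notin> \<int>"
        proof
          assume "z \<in> \<int>"
          then obtain k where "z = of_int k" by (auto elim: Ints_cases)
          with elim False show False by simp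
        qed
        from cot_Digamma[OF this] show ?thesis by (simp add: c_def)
      qed auto
    qed
  qed
  have "G * (fps_exp c - 1) = fps_const (c / 2) * fps_X * (fps_exp c + 1)"
    using lhs rhs has_fps_expansion_cong[OF eq refl] fps_expansion_unique_complex by blast
  \<comment> \<open>The linear correction is the Bernoulli term of index 1, absent from the even
    function \<open>pi z cot (pi z)\<close>.\<close>
  moreover have "fps_const (c / 2) * fps_X * (fps_exp c + 1) + fps_const (c / 2) * fps_X * (fps_exp c - 1)
      = fps_const c * fps_X * fps_exp c"
  proof -
    have "fps_const c = fps_const (c / 2) + fps_const (c / 2)" by simp
    thus ?thesis by (simp only: ring_distribs) simp
  qed
  ultimately have "(G + fps_const (c / 2) * fps_X) * (fps_exp c - 1) = fps_const c * fps_X * fps_exp c"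
    by (simp add: distrib_right)
  also have "\<dots> = Abs_fps (\<lambda>i. c ^ i * Z (1 - of_nat i) / fact i) * (fps_exp c - 1)"
    by (rule zeta_numerator_egf[OF rec, symmetric])
  \<comment> \<open>Formal power series have no zero divisors, and the linear coefficient of
    \<open>fps_exp c - 1\<close> is \<open>c\<close>, which is nonzero.\<close>
  finally have "G + fps_const (c / 2) * fps_X = Abs_fps (\<lambda>i. c ^ i * Z (1 - of_nat i) / fact i)"
  proof (subst (asm) mult_cancel_right, elim disjE)
    assume "fps_exp c - 1 = 0"
    hence "fps_nth (fps_exp c - 1) 1 = 0" by simp
    thus ?thesis by (simp add: c_def)
  qed
  hence "c ^ n * Z (1 - of_nat n) / fact n = fps_nth (G + fps_const (c / 2) * fps_X) n"
    by simp
  \<comment> \<open>As \<open>n \<ge> 2\<close>, the constant and linear corrections do not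
    contribute; for odd \<open>n\<close> the reflected coefficients cancel.\<close>
  also have "\<dots> = ((-1) ^ (n - 1) - 1) * Polygamma (n - 1) 1 / fact (n - 1)"
    using n by (cases n) (auto simp: G_def D_def D'_def algebra_simps diff_divide_distrib)
  also have "\<dots> = (if even n then - 2 * zeta_series (of_nat n) else 0)"
    using n Polygamma_at_1[of "n - 1"] by (cases n) auto
  finally show ?thesis by (simp add: c_def)
qed

text \<open>Moduli remove the powers of \<open>\<i>\<close> and the sign. The denominator
  \<open>s - 1\<close> is \<open>-n\<close> at \<open>s = 1 - n\<close>, which turns
  \<open>fact n\<close> into \<open>fact (n - 1)\<close>.\<close>

lemma norm_zeta_negative_integer:
  assumes "n \<ge> 2"
  shows "cmod (zeta (1 - of_nat n)) =
    (if even n then 2 * fact (n - 1) / (2 * pi) ^ n * cmod (zeta_series (of_nat n)) else 0)"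
proof -
  obtain Z where Z: "\<And>s. zeta s = Z s / (s - 1)"
    and rec: "\<And>K s. Re s > 1 - real K \<Longrightarrow>
      (\<Sum>j<K. ((1 - s) gchoose j) / of_nat (Suc j) * Z (s + of_nat j)) = 1 + taylor_sum K s"
    using zeta_entire_numerator by blast
  have "(2 * pi) ^ n * cmod (Z (1 - of_nat n)) / fact n =
     cmod ((2 * of_real pi * \<i>) ^ n * Z (1 - of_nat n) / fact n)"
    by (simp add: norm_mult norm_divide norm_power)
  also have "\<dots> = (if even n then 2 * cmod (zeta_series (of_nat n)) else 0)"
    by (subst zeta_numerator_at_negatives[OF rec assms]) (auto simp: norm_mult)
  finally have "cmod (Z (1 - of_nat n)) = (if even n then 2 * cmod (zeta_series (of_nat n)) else 0) * fact n / (2 * pi) ^ n"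
    by (simp add: field_simps split: if_splits)
  moreover have "fact n = real n * fact (n - 1)"
    using assms by (simp add: fact_reduce)
  ultimately show ?thesis using assms
    by (simp add: Z norm_divide)
qed

subsection \<open>The normalised moment sums\<close>

lemma zeta_series_of_nat_sums:
  assumes "r \<ge> 2"
  shows "(\<lambda>n. 1 / real (Suc n) ^ r) sums cmod (zeta_series (of_nat r))"
proof -
  have summable: "summable (\<lambda>n. 1 / real (Suc n) ^ r)"
    using inverse_power_summable[OF assms, where 'a = real]
    by (subst (asm) summable_Suc_iff [symmetric]) (simp only: inverse_eq_divide)
  have "(\<lambda>n. of_real (1 / real (Suc n) ^ r)) sums (of_real (\<Sum>n. 1 / real (Suc n) ^ r) :: complex)"
    by (intro sums_of_real summable_sums summable)
  moreover have "of_real (1 / real (Suc n) ^ r) = 1 / (of_nat (Suc n) :: complex) powr of_nat r" for n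
    by (subst powr_nat') (auto simp del: of_nat_Suc)
  moreover have "(\<lambda>n. 1 / of_nat (Suc n) powr of_nat r) sums zeta_series (of_nat r)"
    using assms by (intro zeta_series_sums) auto
  ultimately have "zeta_series (of_nat r) = of_real (\<Sum>n. 1 / real (Suc n) ^ r)"
    by (simp only: sums_unique2)
  moreover have "(\<Sum>n. 1 / real (Suc n) ^ r) \<ge> 0"
    by (intro suminf_nonneg summable) auto
  ultimately show ?thesis
    using summable_sums[OF summable] by simp
qed

text \<open>With \<open>n = N - j\<close>, of the same parity as \<open>j\<close>, the factor
  \<open>2 ^ (n - 1)\<close> and the binomial coefficient cancel all constants in the modulus of
  zeta at \<open>1 - n\<close>.\<close>

lemma norm_t_term:
  assumes "even N" "1 \<le> j" "j \<le> N - 2" "a j \<ge> 0"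
  shows "pi ^ N * cmod (t_term a N j) / fact N =
    (if even j then a j * pi ^ j / fact j * cmod (zeta_series (of_nat (N - j))) else 0)"
proof -
  define n where "n = N - j"
  have n: "n \<ge> 2" "N = n + j" "even n \<longleftrightarrow> even j"
    using assms by (auto simp: n_def)
  have arg: "of_int (int j + 1 - int N) = (1 - of_nat n :: complex)"
    by (simp add: n)
  have choose: "real ((N - 1) choose j) = fact (N - 1) / (fact j * fact (n - 1))"
    using n by (subst binomial_fact) (auto simp: algebra_simps)
  have norm: "cmod (t_term a N j) =
      real N * (fact (N - 1) / (fact j * fact (n - 1))) * a j * 2 ^ (n - 1) * cmod (zeta (1 - of_nat n))"
    unfolding t_term_def arg choose [symmetric] using assms
    by (simp add: norm_mult norm_power n_def)
  have factN: "real N * fact (N - 1) = fact N"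
    using n by (subst (2) fact_reduce) auto
  show ?thesis
  proof (cases "even j")
    case True
    have two: "(2 * pi) ^ n = 2 * 2 ^ (n - 1) * pi ^ n"
      using n by (cases n) (auto simp: power_mult_distrib)
    have "cmod (zeta (1 - of_nat n)) = 2 * fact (n - 1) / (2 * pi) ^ n * cmod (zeta_series (of_nat n))"
      using norm_zeta_negative_integer[OF n(1)] True n(3) by simp
    also have "\<dots> = fact (n - 1) / (2 ^ (n - 1) * pi ^ n) * cmod (zeta_series (of_nat n))"
      unfolding two by simp
    finally have "cmod (t_term a N j) =
        (real N * fact (N - 1)) * (a j / (fact j * pi ^ n)) * cmod (zeta_series (of_nat n))"
      unfolding norm by simp
    hence "cmod (t_term a N j) = fact N * (a j / (fact j * pi ^ n)) * cmod (zeta_series (of_nat n))"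
      unfolding factN .
    moreover have "pi ^ N = pi ^ n * pi ^ j" by (simp add: n(2) power_add)
    ultimately show ?thesis using True by (simp add: n_def)
  next
    case False
    thus ?thesis using norm_zeta_negative_integer[OF n(1)] n(3) by (simp add: norm)
  qed
qed

section \<open>Truncations and tails of the even generating function\<close>

definition even_trunc :: "(nat \<Rightarrow> real) \<Rightarrow> nat \<Rightarrow> real \<Rightarrow> real" where
  "even_trunc a N x = (\<Sum>j | 2 \<le> j \<and> even j \<and> j < N. a j * x ^ j / fact j)"

definition even_tail :: "(nat \<Rightarrow> real) \<Rightarrow> nat \<Rightarrow> real \<Rightarrow> real" where
  "even_tail a N x = (\<Sum>\<^sub>\<infinity>j\<in>{j. j \<ge> N \<and> even j}. a j * x ^ j / fact j)"

text \<open>Expand each zeta value as a Dirichlet series and exchange it with the finite sum over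
  \<open>j\<close>; dividing \<open>m ^ j\<close> by \<open>m ^ N\<close> accounts for the exponent
  \<open>N - j\<close>.\<close>

lemma S_val_sums:
  assumes "even N" "\<And>j. a j \<ge> 0"
  shows "(\<lambda>n. even_trunc a N (real (Suc n) * pi) / real (Suc n) ^ N) sums S_val a N"
proof -
  let ?J = "{j. 2 \<le> j \<and> even j \<and> j < N}"
  have J: "j \<le> N - 2" "j \<ge> 1" if "j \<in> ?J" for j
  proof -
    \<comment> \<open>\<open>N - 1\<close> is odd, so every even \<open>j < N\<close> leaves an
      exponent \<open>N - j\<close> of at least 2, where the series converges.\<close>
    have "j \<noteq> N - 1" using that assms(1) by (metis (no_types, lifting) Suc_diff_1 even_Suc mem_Collect_eq not_less_zero neq0_conv)
    with that show "j \<le> N - 2" "j \<ge> 1" by auto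
  qed
  have "S_val a N = (\<Sum>j=1..N-2. pi ^ N * cmod (t_term a N j) / fact N)"
    by (simp add: S_val_def M_sum_def sum_distrib_left sum_divide_distrib)
  also have "\<dots> = (\<Sum>j\<in>?J. a j * pi ^ j / fact j * cmod (zeta_series (of_nat (N - j))))"
  proof (rule sum.mono_neutral_cong_right)
    show "?J \<subseteq> {1..N-2}" using J by auto
    show "\<forall>j\<in>{1..N-2} - ?J. pi ^ N * cmod (t_term a N j) / fact N = 0"
    proof
      fix j assume j: "j \<in> {1..N-2} - ?J"
      hence "odd j" by (cases "j = 1") auto
      thus "pi ^ N * cmod (t_term a N j) / fact N = 0"
        using norm_t_term[OF assms(1), of j a] j assms(2) by simp
    qed
    show "pi ^ N * cmod (t_term a N j) / fact N = a j * pi ^ j / fact j * cmod (zeta_series (of_nat (N - j)))"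
      if "j \<in> ?J" for j
      using norm_t_term[OF assms(1), of j a] J[OF that] that assms(2) by simp
  qed auto
  finally have S: "S_val a N = (\<Sum>j\<in>?J. a j * pi ^ j / fact j * cmod (zeta_series (of_nat (N - j))))" .
  have "(\<lambda>n. \<Sum>j\<in>?J. a j * pi ^ j / fact j * (1 / real (Suc n) ^ (N - j))) sums S_val a N"
    unfolding S
  proof (intro sums_sum sums_mult zeta_series_of_nat_sums)
    fix j assume "j \<in> ?J"
    with J[OF this] show "2 \<le> N - j" by auto
  qed
  also have "(\<lambda>n. \<Sum>j\<in>?J. a j * pi ^ j / fact j * (1 / real (Suc n) ^ (N - j))) =
      (\<lambda>n. even_trunc a N (real (Suc n) * pi) / real (Suc n) ^ N)"
  proof
    fix n
    have "a j * pi ^ j / fact j * (1 / real (Suc n) ^ (N - j)) =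
        a j * (real (Suc n) * pi) ^ j / fact j / real (Suc n) ^ N" if "j \<in> ?J" for j
    proof -
      have "real (Suc n) ^ N = real (Suc n) ^ j * real (Suc n) ^ (N - j)"
        using that by (simp add: power_add [symmetric] del: of_nat_Suc)
      thus ?thesis by (simp add: power_mult_distrib del: of_nat_Suc)
    qed
    thus "(\<Sum>j\<in>?J. a j * pi ^ j / fact j * (1 / real (Suc n) ^ (N - j))) =
        even_trunc a N (real (Suc n) * pi) / real (Suc n) ^ N"
      unfolding even_trunc_def sum_divide_distrib by (intro sum.cong refl)
  qed
  finally show ?thesis .
qed

lemma exponential_growth_summable:
  fixes a :: "nat \<Rightarrow> real"
  assumes "\<And>j. a j \<ge> 0" "\<And>j. a j \<le> C * \<rho> ^ j"
  shows "(\<lambda>j. a j * x ^ j / fact j) summable_on A"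
proof -
  have "summable (\<lambda>j. norm (a j * x ^ j / fact j))"
  proof (rule summable_comparison_test')
    show "summable (\<lambda>j. C * (inverse (fact j) * (\<rho> * \<bar>x\<bar>) ^ j))"
      by (intro summable_mult summable_exp)
    show "norm (norm (a n * x ^ n / fact n)) \<le> C * (inverse (fact n) * (\<rho> * \<bar>x\<bar>) ^ n)" if "n \<ge> 0" for n
    proof -
      have "norm (norm (a n * x ^ n / fact n)) = a n * (\<bar>x\<bar> ^ n / fact n)"
        using assms(1)[of n] by (simp add: abs_mult power_abs)
      also have "\<dots> \<le> C * \<rho> ^ n * (\<bar>x\<bar> ^ n / fact n)"
        by (intro mult_right_mono assms(2)) auto
      finally show ?thesis by (simp add: power_mult_distrib divide_inverse mult_ac)
    qed
  qed
  hence "(\<lambda>j. a j * x ^ j / fact j) summable_on UNIV"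
    by (rule norm_summable_imp_summable_on)
  thus ?thesis by (rule summable_on_subset) auto
qed

lemma even_egf_split:
  assumes "\<And>j. a j \<ge> 0" "\<And>j. a j \<le> C * \<rho> ^ j" "N \<ge> 2"
  shows "even_egf a x = even_trunc a N x + even_tail a N x"
proof -
  have "{j. j \<ge> 2 \<and> even j} = {j. 2 \<le> j \<and> even j \<and> j < N} \<union> {j. j \<ge> N \<and> even j}"
    using assms(3) by auto
  hence "even_egf a x = (\<Sum>\<^sub>\<infinity>j\<in>{j. 2 \<le> j \<and> even j \<and> j < N} \<union> {j. j \<ge> N \<and> even j}. a j * x ^ j / fact j)"
    by (simp only: even_egf_def)
  also have "\<dots> = even_trunc a N x + even_tail a N x"
    unfolding even_trunc_def even_tail_def
    by (subst infsum_Un_disjoint) (auto intro!: exponential_growth_summable assms(1,2))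
  finally show ?thesis .
qed

section \<open>Positivity, scaling and remainder estimates\<close>

lemma even_trunc_nonneg: "(\<And>j. a j \<ge> 0) \<Longrightarrow> x \<ge> 0 \<Longrightarrow> even_trunc a N x \<ge> 0"
  unfolding even_trunc_def by (intro sum_nonneg) auto

lemma even_tail_nonneg: "(\<And>j. a j \<ge> 0) \<Longrightarrow> x \<ge> 0 \<Longrightarrow> even_tail a N x \<ge> 0"
  unfolding even_tail_def by (intro infsum_nonneg) auto

lemma even_egf_pos:
  assumes "\<And>j. a j \<ge> 0" "\<And>j. a j \<le> C * \<rho> ^ j" "a 2 > 0" "x > 0"
  shows "even_egf a x > 0"
proof -
  \<comment> \<open>Cutting at 3 isolates the term \<open>j = 2\<close>, whose coefficient is
    positive.\<close>
  have set: "{j::nat. 2 \<le> j \<and> even j \<and> j < 3} = {2}" by auto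
  have "even_trunc a 3 x = a 2 * x ^ 2 / fact 2" unfolding even_trunc_def set by simp
  moreover have "a 2 * x ^ 2 / fact 2 > 0" using assms(3,4) by (intro divide_pos_pos mult_pos_pos) auto
  ultimately have "even_trunc a 3 x > 0" by (simp only:)
  moreover have "even_tail a 3 x \<ge> 0" using assms(1,4) by (intro even_tail_nonneg) auto
  ultimately show ?thesis using even_egf_split[OF assms(1,2), of 3 x] by simp
qed

text \<open>Each degree satisfies \<open>N - j \<ge> 2\<close> by parity, so every term loses at
  least the factor \<open>(L / m) ^ 2\<close>.\<close>

lemma even_trunc_scale_le:
  assumes "\<And>j. a j \<ge> 0" "0 < L" "L \<le> m" "x \<ge> 0" "even N"
  shows "even_trunc a N (m * x) / m ^ N \<le> (L / m) ^ 2 * (even_trunc a N (L * x) / L ^ N)"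
  unfolding even_trunc_def sum_divide_distrib sum_distrib_left
proof (rule sum_mono)
  fix j assume j: "j \<in> {j. 2 \<le> j \<and> even j \<and> j < N}"
  hence "even (N - j)" "N - j > 0" using assms(5) by auto
  hence N: "N - j \<ge> 2" by (cases "N - j = 1") auto
  have pow: "y ^ N = y ^ j * y ^ (N - j)" for y :: real
    using j by (simp add: power_add [symmetric])
  have "(L / m) ^ (N - j) \<le> (L / m) ^ 2"
    using N assms by (intro power_decreasing) auto
  hence "1 / m ^ (N - j) \<le> (L / m) ^ 2 * (1 / L ^ (N - j))"
    using assms by (simp add: power_divide field_simps)
  hence "a j * x ^ j / fact j * (1 / m ^ (N - j)) \<le> a j * x ^ j / fact j * ((L / m) ^ 2 * (1 / L ^ (N - j)))"
    using assms by (intro mult_left_mono) auto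
  moreover have "a j * (y * x) ^ j / fact j / y ^ N = a j * x ^ j / fact j * (1 / y ^ (N - j))" if "y > 0" for y
    using that by (simp add: pow power_mult_distrib)
  ultimately show "a j * (m * x) ^ j / fact j / m ^ N \<le> (L / m) ^ 2 * (a j * (L * x) ^ j / fact j / L ^ N)"
    using assms by (simp add: mult_ac)
qed

text \<open>In degrees \<open>j \<ge> N\<close> the quotient \<open>m ^ j / m ^ N\<close> is
  nondecreasing in \<open>m\<close>, opposite to the behaviour of the truncation.\<close>

lemma even_tail_scale_le:
  assumes "\<And>j. a j \<ge> 0" "\<And>j. a j \<le> C * \<rho> ^ j" "0 < m" "m \<le> L" "x \<ge> 0"
  shows "even_tail a N (m * x) / m ^ N \<le> even_tail a N (L * x) / L ^ N"
proof -
  have "even_tail a N (m * x) \<le> (\<Sum>\<^sub>\<infinity>j\<in>{j. j \<ge> N \<and> even j}. a j * (L * x) ^ j / fact j * ((m / L) ^ N))"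
    unfolding even_tail_def
  proof (rule infsum_mono)
    fix j assume j: "j \<in> {j. j \<ge> N \<and> even j}"
    have "(m / L) ^ j \<le> (m / L) ^ N"
      using j assms by (intro power_decreasing) auto
    hence "a j * (L * x) ^ j / fact j * (m / L) ^ j \<le> a j * (L * x) ^ j / fact j * (m / L) ^ N"
      using assms by (intro mult_left_mono) auto
    moreover have "a j * (L * x) ^ j / fact j * (m / L) ^ j = a j * (m * x) ^ j / fact j"
      using assms by (simp add: power_mult_distrib power_divide)
    ultimately show "a j * (m * x) ^ j / fact j \<le> a j * (L * x) ^ j / fact j * (m / L) ^ N" by (simp only:)
  qed (intro summable_on_cmult_left exponential_growth_summable[OF assms(1,2)])+
  also have "\<dots> = even_tail a N (L * x) * (m / L) ^ N"
    unfolding even_tail_def by (rule infsum_cmult_left')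
  finally have "even_tail a N (m * x) / m ^ N \<le> even_tail a N (L * x) * (m / L) ^ N / m ^ N"
    using assms(3) by (intro divide_right_mono) auto
  thus ?thesis using assms(3) by (simp add: power_divide)
qed

text \<open>The term \<open>n = 0\<close> is 1 and the rest is dominated by a telescoping series
  with sum \<open>L\<close>. With \<open>L = K + 1\<close> this is the source of the constant
  \<open>K + 2\<close>.\<close>

lemma shifted_inverse_squares:
  assumes "L > 0"
  shows "summable (\<lambda>n. (real L / real (n + L)) ^ 2)" "(\<Sum>n. (real L / real (n + L)) ^ 2) \<le> real L + 1"
proof -
  have lim: "(\<lambda>n. 1 / real (n + L)) \<longlonglongrightarrow> 0"
    using LIMSEQ_ignore_initial_segment[OF lim_1_over_n] .
  have "(\<lambda>n. 1 / real (n + L) - 1 / real (Suc n + L)) sums (1 / real (0 + L) - 0)"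
    by (rule telescope_sums'[OF lim])
  from sums_mult[OF this, of "real L ^ 2"]
  have tele: "(\<lambda>n. real L ^ 2 * (1 / real (n + L) - 1 / real (Suc n + L))) sums real L"
    using assms by (simp add: power2_eq_square)
  have le: "(real L / real (Suc n + L)) ^ 2 \<le> real L ^ 2 * (1 / real (n + L) - 1 / real (Suc n + L))" for n
  proof -
    define y where "y = real (n + L)"
    have y: "y > 0" "real (Suc n + L) = y + 1" using assms by (simp_all add: y_def)
    have "1 / (y + 1) ^ 2 \<le> 1 / y - 1 / (y + 1)"
    proof -
      have "1 / y - 1 / (y + 1) = 1 / (y * (y + 1))" using y by (simp add: field_simps)
      moreover have "1 / (y + 1) ^ 2 \<le> 1 / (y * (y + 1))"
        using y by (intro divide_left_mono) (auto simp: power2_eq_square)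
      ultimately show ?thesis by simp
    qed
    hence "real L ^ 2 * (1 / (y + 1) ^ 2) \<le> real L ^ 2 * (1 / y - 1 / (y + 1))"
      by (intro mult_left_mono) auto
    thus ?thesis unfolding y(2) y_def [symmetric] by (simp add: power_divide)
  qed
  have sum': "summable (\<lambda>n. (real L / real (Suc n + L)) ^ 2)"
    by (rule summable_comparison_test'[OF sums_summable[OF tele], of 0]) (use le in auto)
  thus sum: "summable (\<lambda>n. (real L / real (n + L)) ^ 2)"
    by (subst summable_Suc_iff [symmetric])
  have "(\<Sum>n. (real L / real (Suc n + L)) ^ 2) \<le> real L"
    using suminf_le[OF le sum' sums_summable[OF tele]] sums_unique[OF tele] by metis
  thus "(\<Sum>n. (real L / real (n + L)) ^ 2) \<le> real L + 1"
    using suminf_split_head[OF sum] assms by simp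
qed

text \<open>The remainder is the sum of the truncations for \<open>m > K\<close> minus the sum of
  the tails for \<open>m \<le> K\<close>. Both are nonnegative and are bounded by the truncation and
  the tail at \<open>L = K + 1\<close>.\<close>

lemma S_val_remainder_bound:
  assumes a: "\<And>j. a j \<ge> 0" "\<And>j. a j \<le> C * \<rho> ^ j" and N: "N \<ge> 4" "even N"
  shows "\<bar>S_val a N - (\<Sum>m=1..K. even_egf a (real m * pi) / real m ^ N)\<bar>
           \<le> real (K + 2) * even_egf a (real (K + 1) * pi) / real (K + 1) ^ N"
proof -
  define L where "L = K + 1"
  define T where "T = (\<lambda>m. even_trunc a N (real m * pi) / real m ^ N)"
  define U where "U = (\<lambda>m. even_tail a N (real m * pi) / real m ^ N)"
  have split: "even_egf a (real m * pi) / real m ^ N = T m + U m" for m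
    using N by (simp add: T_def U_def even_egf_split[OF a, of N] add_divide_distrib)
  have nonneg: "T m \<ge> 0" "U m \<ge> 0" for m
    unfolding T_def U_def using a by (auto intro!: divide_nonneg_nonneg even_trunc_nonneg even_tail_nonneg)
  have S: "(\<lambda>n. T (Suc n)) sums S_val a N"
    unfolding T_def by (rule S_val_sums[OF N(2) a(1)])
  have "(\<lambda>n. T (n + L)) sums (S_val a N - (\<Sum>m<K. T (Suc m)))"
    using sums_split_initial_segment[OF S, of K] by (simp add: L_def)
  moreover have "(\<Sum>m<K. T (Suc m)) = (\<Sum>m=1..K. T m)"
    by (rule sum.reindex_bij_witness[of _ "\<lambda>m. m - 1" Suc]) auto
  ultimately have sums: "(\<lambda>n. T (n + L)) sums (S_val a N - (\<Sum>m=1..K. T m))" by simp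
  have head: "S_val a N - (\<Sum>m=1..K. T m) \<le> real (K + 2) * T L"
  proof -
    have "L > 0" by (simp add: L_def)
    note sq = shifted_inverse_squares[OF this]
    have "S_val a N - (\<Sum>m=1..K. T m) \<le> (\<Sum>n. (real L / real (n + L)) ^ 2 * T L)"
      unfolding sums_unique[OF sums]
    proof (intro suminf_le summable_mult2 sq(1) sums_summable[OF sums])
      fix n show "T (n + L) \<le> (real L / real (n + L)) ^ 2 * T L"
        unfolding T_def using a N by (intro even_trunc_scale_le) (auto simp: L_def)
    qed
    also have "\<dots> = (\<Sum>n. (real L / real (n + L)) ^ 2) * T L"
      by (rule suminf_mult2 [symmetric, OF sq(1)])
    also have "\<dots> \<le> (real L + 1) * T L"
      by (intro mult_right_mono sq(2) nonneg)
    finally show ?thesis by (simp add: L_def algebra_simps)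
  qed
  have head0: "S_val a N - (\<Sum>m=1..K. T m) \<ge> 0"
    unfolding sums_unique[OF sums] using nonneg by (intro suminf_nonneg sums_summable[OF sums]) auto
  have "(\<Sum>m=1..K. U m) \<le> (\<Sum>m=1..K. U L)"
  proof (rule sum_mono)
    fix m assume "m \<in> {1..K}"
    thus "U m \<le> U L"
      unfolding U_def by (intro even_tail_scale_le[OF a]) (auto simp: L_def)
  qed
  \<comment> \<open>The constant \<open>K\<close> is enlarged to that of the truncation part, so
    that \<open>T L\<close> and \<open>U L\<close> recombine into the full generating
    function.\<close>
  also have "\<dots> \<le> real (K + 2) * U L"
    using nonneg by (simp add: mult_right_mono)
  finally have tail: "(\<Sum>m=1..K. U m) \<le> real (K + 2) * U L" .
  have "\<bar>S_val a N - (\<Sum>m=1..K. T m) - (\<Sum>m=1..K. U m)\<bar> \<le> real (K + 2) * T L + real (K + 2) * U L"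
  proof -
    have "(\<Sum>m=1..K. U m) \<ge> 0" by (intro sum_nonneg nonneg)
    moreover have "real (K + 2) * T L \<ge> 0" "real (K + 2) * U L \<ge> 0" using nonneg by simp_all
    ultimately show ?thesis using head head0 tail by linarith
  qed
  also have "\<dots> = real (K + 2) * even_egf a (real (K + 1) * pi) / real (K + 1) ^ N"
    unfolding L_def by (simp only: times_divide_eq_right [symmetric] split distrib_left)
  finally show ?thesis
    unfolding split sum.distrib by (simp only: diff_diff_eq)
qed

text \<open>The remainder bound for \<open>K + 1\<close> subtracts one more summand, and the
  normalising factor \<open>q\<close> turns exactly that summand into 1.\<close>

lemma H_val_bound:
  assumes a: "\<And>j. a j \<ge> 0" "\<And>j. a j \<le> C * \<rho> ^ j" "a 2 > 0" and N: "N \<ge> 4" "even N"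
  shows "\<bar>H_val a N K - 1\<bar> \<le>
           real (K + 3) * even_egf a (real (K + 2) * pi) / even_egf a (real (K + 1) * pi)
           * (real (K + 1) / real (K + 2)) ^ N"
proof -
  define E where "E = even_egf a (real (K + 1) * pi)"
  have E: "E > 0" unfolding E_def using a by (intro even_egf_pos[OF a]) auto
  define q where "q = real (K + 1) ^ N / E"
  have q: "q > 0" using E by (simp add: q_def)
  define D where "D = S_val a N - (\<Sum>m=1..K. even_egf a (real m * pi) / real m ^ N)"
  have D: "\<bar>D - E / real (K + 1) ^ N\<bar> \<le>
      real (K + 3) * even_egf a (real (K + 2) * pi) / real (K + 2) ^ N"
    using S_val_remainder_bound[OF a(1,2) N, of "K + 1"]
    by (simp add: D_def E_def algebra_simps numeral_eq_Suc)
  have "q * (E / real (K + 1) ^ N) = 1"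
    using E by (simp add: q_def)
  moreover have "H_val a N K = q * D"
    by (simp add: H_val_def q_def E_def D_def)
  ultimately have "H_val a N K - 1 = q * (D - E / real (K + 1) ^ N)"
    by (simp only: right_diff_distrib)
  hence "\<bar>H_val a N K - 1\<bar> = q * \<bar>D - E / real (K + 1) ^ N\<bar>"
    using q by (simp add: abs_mult)
  also have "\<dots> \<le> q * (real (K + 3) * even_egf a (real (K + 2) * pi) / real (K + 2) ^ N)"
    using q D by (intro mult_left_mono) auto
  also have "\<dots> = real (K + 3) * even_egf a (real (K + 2) * pi) / E * (real (K + 1) / real (K + 2)) ^ N"
    by (simp add: q_def power_divide)
  finally show ?thesis unfolding E_def .
qed

theorem theorem5:
  fixes a :: "nat \<Rightarrow> real" and C \<rho> :: real
  assumes "a 0 = 0"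
    and "\<And>j. j \<ge> 1 \<Longrightarrow> a j \<ge> 0"
    and "a 2 > 0"
    and "C > 0" and "\<rho> > 0"
    and "\<And>j. a j \<le> C * \<rho> ^ j"
  shows "(\<forall>K N. K \<ge> 1 \<and> N \<ge> 4 \<and> even N \<longrightarrow>
           (\<exists>R. S_val a N = (\<Sum>m=1..K. even_egf a (real m * pi) / real m ^ N) + R \<and>
                \<bar>R\<bar> \<le> real (K + 2) * even_egf a (real (K + 1) * pi) / real (K + 1) ^ N))
       \<and> (\<forall>K. ((\<lambda>n. H_val a (2 * n) K) \<longlonglongrightarrow> 1) \<and>
           (\<forall>N. N \<ge> 4 \<and> even N \<longrightarrow>
             \<bar>H_val a N K - 1\<bar> \<le>
               real (K + 3) * even_egf a (real (K + 2) * pi) / even_egf a (real (K + 1) * pi)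
               * (real (K + 1) / real (K + 2)) ^ N))"
proof -
  \<comment> \<open>The value \<open>a 0 = 0\<close> covers the index left out by the sign
    hypothesis.\<close>
  have nonneg: "a j \<ge> 0" for j
    using assms(1,2) by (cases j) auto
  note S_bound = S_val_remainder_bound[OF nonneg assms(6)]
  note H_bound = H_val_bound[OF nonneg assms(6) assms(3)]
  have "(\<lambda>n. H_val a (2 * n) K) \<longlonglongrightarrow> 1" for K
  proof (rule LIM_zero_cancel, rule Lim_null_comparison)
    let ?c = "real (K + 3) * even_egf a (real (K + 2) * pi) / even_egf a (real (K + 1) * pi)"
    let ?q = "real (K + 1) / real (K + 2)"
    \<comment> \<open>The bound requires \<open>2 * n \<ge> 4\<close>, hence
      \<open>n \<ge> 2\<close>; it is geometric in \<open>n\<close> with ratio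
      \<open>?q ^ 2 < 1\<close>.\<close>
    show "\<forall>\<^sub>F n in sequentially. norm (H_val a (2 * n) K - 1) \<le> ?c * ?q ^ (2 * n)"
      using eventually_ge_at_top[of 2]
    proof eventually_elim
      case (elim n)
      thus ?case using H_bound[of "2 * n" K] by (simp only: real_norm_def) simp
    qed
    have "(\<lambda>n. (?q ^ 2) ^ n) \<longlonglongrightarrow> 0"
      by (intro LIMSEQ_power_zero) (auto simp: power_less_one_iff abs_if)
    from tendsto_mult_right_zero[OF this, of ?c]
    show "(\<lambda>n. ?c * ?q ^ (2 * n)) \<longlonglongrightarrow> 0"
      by (simp only: power_mult)
  qed
  moreover have "\<exists>R. S_val a N = (\<Sum>m=1..K. even_egf a (real m * pi) / real m ^ N) + R \<and>
                \<bar>R\<bar> \<le> real (K + 2) * even_egf a (real (K + 1) * pi) / real (K + 1) ^ N"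
    if "N \<ge> 4" "even N" for K N
    using S_bound[OF that, of K]
    by (intro exI[of _ "S_val a N - (\<Sum>m=1..K. even_egf a (real m * pi) / real m ^ N)"]) auto
  ultimately show ?thesis using H_bound by blast
qed

end
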